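(* Let $N\ge2$, let $-1=x_0<x_1<\cdots<x_N=1$, and let $\mathcal S=\{s_1,\ldots,s_N\}$ be a family of intervals $s_i=[x_{\ell_i},x_{r_i}]$ with integers $0\le\ell_i<r_i\le N$. Let $\alpha,\beta>-1$, $\zeta\in\{-1,1\}$, and $W_N=\operatorname{diag}(w_1,\ldots,w_N)$ with $w_i>0$ for all $i$. The following statements are equivalent: (1) the endpoint graph $\mathcal G_{\mathcal S}$ is connected; (2) the bilinear form $[\cdot,\cdot]_{\mathcal S,W_N}^{(\zeta)}$ is an inner product on $\Pi_{N-1}$.
   Context: $\Pi_{N-1}$ is the space of real polynomials of degree at most $N-1$. The endpoint graph $\mathcal G_{\mathcal S}$ is the undirected graph with vertex set $\{0,\ldots,N\}$ and edge set $\{\{\ell_i,r_i\}:i=1,\ldots,N\}$. The weight is $\omega_{\alpha,\beta}^{(\zeta)}(x)=(1-\zeta x)(1-x)^\alpha(1+x)^\beta$ on $(-1,1)$. For $p\in\Pi_{N-1}$ the moment vector is $$\boldsymbol m_{\mathcal S}^{(\zeta)}(p)=\left(\int_{s_1}p(x)\omega_{\alpha,\beta}^{(\zeta)}(x)\,dx,\ldots,\int_{s_N}p(x)\omega_{\alpha,\beta}^{(\zeta)}(x)\,dx\right)^\top,$$ and $[p,q]_{\mathcal S,W_N}^{(\zeta)}=\left(\boldsymbol m_{\mathcal S}^{(\zeta)}(p)\right)^\top W_N\,\boldsymbol m_{\mathcal S}^{(\zeta)}(q)$ for $p,q\in\Pi_{N-1}$. *)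

theory Defs
  imports
    "HOL-Analysis.Analysis"
    "HOL-Computational_Algebra.Polynomial"
    "Jordan_Normal_Form.Matrix"
    "Graph_Theory.Digraph_Component"
begin

definition poly_space :: "nat \<Rightarrow> real poly set" where
  "poly_space d = {p. degree p \<le> d}"

definition endpoint_edges :: "nat \<Rightarrow> (nat \<Rightarrow> nat) \<Rightarrow> (nat \<Rightarrow> nat) \<Rightarrow> nat set set" where
  "endpoint_edges N l r = {{l i, r i} | i. i \<in> {1..N}}"

(* Graph_Theory represents an undirected graph by the digraph that contains both
   orientations of every edge. *)
definition endpoint_graph ::
    "nat \<Rightarrow> (nat \<Rightarrow> nat) \<Rightarrow> (nat \<Rightarrow> nat) \<Rightarrow> nat pair_pre_digraph" where
  "endpoint_graph N l r =
     \<lparr>pverts = {0..N}, parcs = {(u, v). {u, v} \<in> endpoint_edges N l r}\<rparr>"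

(* Only the values on (-1,1) matter: the integrals below are over subintervals of [-1,1],
   and the endpoints, where powr may return a conventional value, form a null set. *)
definition jacobi_weight :: "real \<Rightarrow> real \<Rightarrow> real \<Rightarrow> real \<Rightarrow> real" where
  "jacobi_weight \<alpha> \<beta> \<zeta> x = (1 - \<zeta> * x) * (1 - x) powr \<alpha> * (1 + x) powr \<beta>"

(* The intervals s are indexed by 1..N; vectors and matrices are indexed from 0. *)
definition moment_vec ::
    "real \<Rightarrow> real \<Rightarrow> real \<Rightarrow> nat \<Rightarrow> (nat \<Rightarrow> real set) \<Rightarrow> real poly \<Rightarrow> real Matrix.vec" where
  "moment_vec \<alpha> \<beta> \<zeta> N s p =
     Matrix.vec N (\<lambda>i. LINT x:s (Suc i)|lborel. poly p x * jacobi_weight \<alpha> \<beta> \<zeta> x)"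

definition moment_form ::
    "real \<Rightarrow> real \<Rightarrow> real \<Rightarrow> nat \<Rightarrow> (nat \<Rightarrow> real set) \<Rightarrow> real mat \<Rightarrow>
     real poly \<Rightarrow> real poly \<Rightarrow> real" where
  "moment_form \<alpha> \<beta> \<zeta> N s W p q =
     scalar_prod (moment_vec \<alpha> \<beta> \<zeta> N s p) (mult_mat_vec W (moment_vec \<alpha> \<beta> \<zeta> N s q))"

(* Linearity in the second argument follows from symmetry. *)
definition inner_product_on ::
    "real poly set \<Rightarrow> (real poly \<Rightarrow> real poly \<Rightarrow> real) \<Rightarrow> bool" where
  "inner_product_on V B \<longleftrightarrow>
     (\<forall>p\<in>V. \<forall>q\<in>V. B p q = B q p) \<and>
     (\<forall>p\<in>V. \<forall>q\<in>V. \<forall>u\<in>V. B (p + q) u = B p u + B q u) \<and>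
     (\<forall>c. \<forall>p\<in>V. \<forall>q\<in>V. B (Polynomial.smult c p) q = c * B p q) \<and>
     (\<forall>p\<in>V. p \<noteq> 0 \<longrightarrow> B p p > 0)"

end

theory Submission
  imports Defs "Jordan_Normal_Form.Determinant"
begin

text \<open>
  For a polynomial \<open>p\<close> let \<open>F\<^sub>p(j)\<close> be the weighted integral of \<open>p\<close> from \<open>x\<^sub>0\<close> to the node \<open>x\<^sub>j\<close>.
  The integral over the interval \<open>s\<^sub>i\<close> is then the difference of \<open>F\<^sub>p\<close> along the edge
  \<open>{l\<^sub>i, r\<^sub>i}\<close> of the endpoint graph. The form is symmetric, bilinear and positive semidefinite
  whatever the intervals are, and because the \<open>w\<^sub>i\<close> are positive it vanishes at \<open>p\<close> exactly when
  \<open>F\<^sub>p\<close> takes the same value at the two ends of every edge. A graph is connected if and only if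
  the functions with that property are the constant ones
  (\<open>connected_endpoint_graph_iff\<close>), so it remains to compare the polynomials with the functions on
  the vertices.

  The map \<open>p \<mapsto> F\<^sub>p\<close> is a bijection from the polynomials of degree below \<open>N\<close> onto the functions on
  \<open>{0, \<dots>, N}\<close> that vanish at \<open>0\<close>. It is injective because a polynomial whose weighted integral
  over each of the \<open>N\<close> cells \<open>[x\<^sub>j, x\<^bsub>j+1\<^esub>]\<close> is zero has a root inside each cell, which is more roots
  than its degree allows (\<open>cell_moments_zero_imp_zero\<close>). Both spaces have dimension \<open>N\<close>, so it is
  also surjective (\<open>polynomial_with_nodal_primitive\<close>). Through this bijection, edge-invariant
  functions that vanish at \<open>0\<close> correspond to polynomials at which the form vanishes: all of the
  former are zero exactly when the graph is connected, all of the latter exactly when the form is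
  definite.
\<close>

section \<open>Polynomials and their integrals over the cells of a partition\<close>

text \<open>
  Positivity leaves out the endpoints because a Jacobi weight may vanish or blow up there.
\<close>

locale polynomial_weight =
  fixes a b :: real and \<omega> :: "real \<Rightarrow> real"
  assumes integrable: "set_integrable lborel {a..b} (\<lambda>t. poly p t * \<omega> t)"
    and positive: "a < t \<Longrightarrow> t < b \<Longrightarrow> \<omega> t > 0"
begin

definition moment :: "real \<Rightarrow> real \<Rightarrow> real poly \<Rightarrow> real" where
  "moment u v p = (LINT t:{u..v}|lborel. poly p t * \<omega> t)"

lemma integrable_subinterval:
  assumes "a \<le> u" "v \<le> b"
  shows "set_integrable lborel {u..v} (\<lambda>t. poly p t * \<omega> t)"
  by (rule set_integrable_subset[OF integrable]) (use assms in auto)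

lemma moment_add:
  assumes "a \<le> u" "v \<le> b"
  shows "moment u v (p + q) = moment u v p + moment u v q"
  using integrable_subinterval[OF assms, of p] integrable_subinterval[OF assms, of q]
  by (simp add: moment_def distrib_right)

lemma moment_smult: "moment u v (Polynomial.smult c p) = c * moment u v p"
  by (simp add: moment_def mult.assoc)

lemma moment_zero [simp]: "moment u v 0 = 0"
  using moment_smult[of u v 0 0] by simp

lemma moment_sum:
  assumes "a \<le> u" "v \<le> b" "finite J"
  shows "moment u v (\<Sum>j\<in>J. p j) = (\<Sum>j\<in>J. moment u v (p j))"
  using assms(3) by induction (simp_all add: moment_add assms)

lemma moment_split:
  assumes "a \<le> u" "u \<le> v" "v \<le> z" "z \<le> b"
  shows "moment u v p + moment v z p = moment u z p"
proof -
  let ?f = "\<lambda>t. poly p t * \<omega> t"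
  have eq: "moment c d p = integral {c..d} ?f" if "a \<le> c" "d \<le> b" for c d
    unfolding moment_def
    by (rule set_borel_integral_eq_integral(2)[OF integrable_subinterval[OF that]])
  have "?f integrable_on {u..z}"
    by (rule set_borel_integral_eq_integral(1)[OF integrable_subinterval]) (use assms in auto)
  then show ?thesis
    using assms by (simp add: eq Henstock_Kurzweil_Integration.integral_combine)
qed

text \<open>
  A polynomial without a root in \<open>(u, v)\<close> has constant sign there, and its integral against a
  positive weight then cannot vanish.
\<close>

lemma moment_zero_imp_root:
  assumes "a \<le> u" "u < v" "v \<le> b" and zero: "moment u v p = 0"
  obtains t where "u < t" "t < v" "poly p t = 0"
proof (rule ccontr)
  assume "\<not> thesis"
  with that have no_root: "poly p t \<noteq> 0" if "u < t" "t < v" for t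
    using that by blast
  define m where "m = (u + v) / 2"
  have m: "u < m" "m < v"
    using \<open>u < v\<close> by (simp_all add: m_def)
  \<comment> \<open>The factor \<open>p(m)\<close> normalises the sign: \<open>q(m)\<close> is a nonzero square.\<close>
  define q where "q = Polynomial.smult (poly p m) p"
  have q_pos: "poly q t > 0" if t: "u < t" "t < v" for t
  proof (rule ccontr)
    assume "\<not> poly q t > 0"
    moreover have "poly p m * poly p t \<noteq> 0"
      using no_root m t by simp
    ultimately have neg: "poly p m * poly p t < 0"
      unfolding q_def poly_smult by linarith
    then have "m \<noteq> t"
      using zero_le_square[of "poly p m"] by (auto simp: not_le[symmetric] simp del: zero_le_square)
    then consider "m < t" | "t < m" by linarith
    then show False
    proof cases
      case 1
      then show False using poly_IVT[OF 1, of p] neg no_root m t by force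
    next
      case 2
      then show False using poly_IVT[OF 2, of p] neg no_root m t by (force simp: mult.commute)
    qed
  qed
  let ?f = "\<lambda>t. indicator {u..v} t *\<^sub>R (poly q t * \<omega> t)"
  have f_pos: "?f t > 0" if "u < t" "t < v" for t
    using q_pos[OF that] positive[of t] that assms by simp
  have int: "integrable lborel ?f"
    using integrable_subinterval[of u v q] assms by (simp add: set_integrable_def)
  have "moment u v q = 0"
    by (simp add: q_def moment_smult zero)
  then have "integral\<^sup>L lborel ?f = 0"
    by (simp add: moment_def set_lebesgue_integral_def)
  \<comment> \<open>At \<open>u\<close> and \<open>v\<close> themselves the weight may have any sign.\<close>
  moreover have "AE t in lborel. 0 \<le> ?f t"
    using AE_lborel_singleton[of u] AE_lborel_singleton[of v]
  proof eventually_elim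
    case (elim t)
    show ?case
      using f_pos[of t] elim by (cases "u < t \<and> t < v") (auto simp: indicator_def)
  qed
  ultimately have "AE t in lborel. ?f t = 0"
    using integral_nonneg_eq_0_iff_AE[OF int] by blast
  then have "AE t in lborel. t \<notin> {u<..<v}"
    by eventually_elim (use f_pos in force)
  then have "{u<..<v} \<in> null_sets lborel"
    by (subst AE_iff_null_sets) auto
  then show False
    using \<open>u < v\<close> by (auto simp: null_sets_def)
qed

text \<open>
  The roots found in the \<open>N\<close> open cells are distinct because the cells are disjoint.
\<close>

lemma cell_moments_zero_imp_zero:
  fixes x :: "nat \<Rightarrow> real"
  assumes x: "strict_mono_on {0..N} x" "a \<le> x 0" "x N \<le> b"
    and deg: "degree p < N" and zero: "\<And>j. j < N \<Longrightarrow> moment (x j) (x (Suc j)) p = 0"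
  shows "p = 0"
proof (rule ccontr)
  assume "p \<noteq> 0"
  have mono: "x i \<le> x j" if "i \<le> j" "j \<le> N" for i j
    using strict_mono_on_leD[OF x(1)] that by simp
  have "\<exists>t. x j < t \<and> t < x (Suc j) \<and> poly p t = 0" if "j < N" for j
  proof -
    have "a \<le> x j" "x (Suc j) \<le> b"
      using mono[of 0 j] mono[of "Suc j" N] x that by auto
    moreover have "x j < x (Suc j)"
      using strict_mono_onD[OF x(1)] that by simp
    ultimately show ?thesis
      using moment_zero_imp_root[OF _ _ _ zero[OF that]] by metis
  qed
  then obtain t where t: "\<And>j. j < N \<Longrightarrow> x j < t j \<and> t j < x (Suc j) \<and> poly p (t j) = 0"
    by metis
  have less: "t i < t j" if "i < j" "j < N" for i j
    using t[of i] t[of j] mono[of "Suc i" j] that by force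
  have "inj_on t {..<N}"
    by (rule inj_onI) (metis less lessThan_iff nat_neq_iff order_less_irrefl)
  then have "N = card (t ` {..<N})"
    by (simp add: card_image)
  also have "\<dots> \<le> card {y. poly p y = 0}"
    by (rule card_mono) (use t poly_roots_finite[OF \<open>p \<noteq> 0\<close>] in auto)
  also have "\<dots> \<le> degree p"
    by (rule card_poly_roots_bound[OF \<open>p \<noteq> 0\<close>])
  finally show False using deg by simp
qed

text \<open>
  In the monomial basis the cell integrals are given by a square matrix. By the previous lemma its
  kernel is trivial, so it is invertible and every vector of prescribed integrals is attained.
\<close>

lemma cell_moments_unisolvent:
  fixes x c :: "nat \<Rightarrow> real"
  assumes x: "strict_mono_on {0..N} x" "a \<le> x 0" "x N \<le> b" and "N > 0"
  obtains p where "degree p < N" "\<And>j. j < N \<Longrightarrow> moment (x j) (x (Suc j)) p = c j"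
proof -
  let ?\<mu> = "\<lambda>i. moment (x i) (x (Suc i))"
  define P :: "real Matrix.vec \<Rightarrow> real poly"
    where "P v = (\<Sum>j<N. Polynomial.smult (vec_index v j) (monom 1 j))" for v
  define A where "A = Matrix.mat N N (\<lambda>(i, j). ?\<mu> i (monom 1 j))"
  have A: "A \<in> carrier_mat N N"
    by (simp add: A_def)
  have coeff_P: "coeff (P v) j = (if j < N then vec_index v j else 0)" for v j
    by (simp add: P_def coeff_sum if_distrib cong: if_cong)
  have deg_P: "degree (P v) < N" for v
    using \<open>N > 0\<close> by (intro degree_lessI) (auto simp: coeff_P)
  have A_P: "vec_index (A *\<^sub>v v) i = ?\<mu> i (P v)" if "v \<in> carrier_vec N" "i < N" for v i
  proof -
    have "a \<le> x i" "x (Suc i) \<le> b"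
      using strict_mono_on_leD[OF x(1), of 0 i] strict_mono_on_leD[OF x(1), of "Suc i" N] x that
      by auto
    then have "?\<mu> i (P v) = (\<Sum>j<N. vec_index v j * ?\<mu> i (monom 1 j))"
      by (simp add: P_def moment_sum moment_smult)
    also have "\<dots> = vec_index (A *\<^sub>v v) i"
      using that by (simp add: A_def scalar_prod_def lessThan_atLeast0 mult.commute)
    finally show ?thesis by simp
  qed
  have "det A \<noteq> 0"
  proof
    assume "det A = 0"
    then obtain v where v: "v \<in> carrier_vec N" "v \<noteq> 0\<^sub>v N" "A *\<^sub>v v = 0\<^sub>v N"
      using det_0_iff_vec_prod_zero_field[OF A] by blast
    have "P v = 0"
    proof (rule cell_moments_zero_imp_zero[OF x deg_P])
      show "?\<mu> j (P v) = 0" if "j < N" for j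
        using A_P[OF v(1) that] v(3) that by simp
    qed
    then have "vec_index v j = 0" if "j < N" for j
      using coeff_P[of v j] that by simp
    then have "v = 0\<^sub>v N"
      using v(1) by (intro eq_vecI) auto
    with v(2) show False by contradiction
  qed
  then have "A \<in> Units (ring_mat TYPE(real) N ())"
    by (rule det_non_zero_imp_unit[OF A])
  then obtain B where B: "B \<in> carrier_mat N N" "A * B = 1\<^sub>m N"
    by (auto simp: Units_def ring_mat_def)
  define v where "v = B *\<^sub>v Matrix.vec N c"
  have v: "v \<in> carrier_vec N"
    using B by (simp add: v_def)
  have "A *\<^sub>v v = (A * B) *\<^sub>v Matrix.vec N c"
    unfolding v_def by (rule assoc_mult_mat_vec[OF A B(1), symmetric]) simp
  then have "A *\<^sub>v v = Matrix.vec N c"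
    using B by simp
  then have "?\<mu> j (P v) = c j" if "j < N" for j
    using A_P[OF v that] that by simp
  with deg_P[of v] show thesis
    by (rule that)
qed

lemma moment_between_nodes:
  fixes x :: "nat \<Rightarrow> real"
  assumes x: "strict_mono_on {0..N} x" "a \<le> x 0" "x N \<le> b" and "i \<le> j" "j \<le> N"
  shows "moment (x i) (x j) p = moment (x 0) (x j) p - moment (x 0) (x i) p"
  using moment_split[of "x 0" "x i" "x j" p] strict_mono_on_leD[OF x(1), of 0 i]
    strict_mono_on_leD[OF x(1), of i j] strict_mono_on_leD[OF x(1), of j N] assms by simp

text \<open>
  Prescribing the weighted primitive at the nodes, up to its value at the first one, amounts to
  prescribing the increments over the cells.
\<close>

lemma polynomial_with_nodal_primitive:
  fixes x f :: "nat \<Rightarrow> real"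
  assumes x: "strict_mono_on {0..N} x" "a \<le> x 0" "x N \<le> b" and "N > 0"
  obtains p where "degree p < N" "\<And>j. j \<le> N \<Longrightarrow> moment (x 0) (x j) p = f j - f 0"
proof -
  obtain p where p: "degree p < N" "\<And>j. j < N \<Longrightarrow> moment (x j) (x (Suc j)) p = f (Suc j) - f j"
    using cell_moments_unisolvent[OF x \<open>N > 0\<close>, of "\<lambda>j. f (Suc j) - f j"] by blast
  have "moment (x 0) (x j) p = f j - f 0" if "j \<le> N" for j
    using that
  proof (induction j)
    case 0
    then show ?case
      using moment_between_nodes[OF x, of 0 0 p] by simp
  next
    case (Suc j)
    then show ?case
      using moment_between_nodes[OF x, of j "Suc j" p] p(2)[of j] by simp
  qed
  with p(1) show thesis by (rule that)
qed

end

section \<open>Jacobi weights\<close>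

text \<open>
  The affine change of variable \<open>t \<mapsto> (1 + t) / 2\<close> turns the integral of
  \<open>(1 - t)\<^sup>\<alpha> (1 + t)\<^sup>\<beta>\<close> into an Euler Beta integral, which converges since both exponents exceed
  \<open>-1\<close>. The remaining factors are continuous, hence bounded on \<open>[-1, 1]\<close>.
\<close>

lemma jacobi_polynomial_weight:
  assumes "\<alpha> > -1" "\<beta> > -1" and \<zeta>: "\<zeta> \<in> {-1, 1}"
  shows "polynomial_weight (-1) 1 (jacobi_weight \<alpha> \<beta> \<zeta>)"
proof
  fix p :: "real poly"
  let ?g = "\<lambda>t::real. (1 - t) powr \<alpha> * (1 + t) powr \<beta>"
  have "((\<lambda>t. ((1/2) *\<^sub>R t + 1/2) powr (\<beta> + 1 - 1) * (1 - ((1/2) *\<^sub>R t + 1/2)) powr (\<alpha> + 1 - 1))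
      has_integral (Beta (\<beta> + 1) (\<alpha> + 1) /\<^sub>R (1/2) ^ DIM(real)))
      (cbox ((0 - 1/2) /\<^sub>R (1/2)) ((1 - 1/2) /\<^sub>R (1/2)))"
    using has_integral_Beta_real[of "\<beta> + 1" "\<alpha> + 1"] assms by (intro has_integral_affinity') auto
  then have "(\<lambda>t. ((1 + t) / 2) powr \<beta> * ((1 - t) / 2) powr \<alpha>) integrable_on {-1..1}"
    by (auto simp: integrable_on_def field_simps)
  then have "(\<lambda>t. 2 powr (\<alpha> + \<beta>) * (((1 + t) / 2) powr \<beta> * ((1 - t) / 2) powr \<alpha>))
      integrable_on {-1..1}"
    using integrable_on_mult_right by blast
  then have "?g integrable_on {-1..1}"
    by (rule integrable_eq) (auto simp: powr_divide powr_add field_simps)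
  then have "?g absolutely_integrable_on {-1..1}"
    by (rule nonnegative_absolutely_integrable_1) auto
  moreover have cont: "continuous_on {-1..1} (\<lambda>t. poly p t * (1 - \<zeta> * t))"
    by (intro continuous_intros)
  ultimately have "(\<lambda>t. (poly p t * (1 - \<zeta> * t)) * ?g t) absolutely_integrable_on {-1..1}"
    by (intro absolutely_integrable_bounded_measurable_product_real
          [where f = "\<lambda>t. poly p t * (1 - \<zeta> * t)"]
        continuous_imp_measurable_on_sets_lebesgue compact_imp_bounded compact_continuous_image)
      auto
  moreover have "(\<lambda>t. (poly p t * (1 - \<zeta> * t)) * ?g t) = (\<lambda>t. poly p t * jacobi_weight \<alpha> \<beta> \<zeta> t)"
    by (simp add: jacobi_weight_def fun_eq_iff)
  ultimately have "(\<lambda>t. poly p t * jacobi_weight \<alpha> \<beta> \<zeta> t) absolutely_integrable_on {-1..1}"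
    by simp
  moreover have "poly p \<in> borel_measurable borel"
    by (intro borel_measurable_continuous_onI continuous_intros)
  then have "(\<lambda>t. indicator {-1..1} t *\<^sub>R (poly p t * jacobi_weight \<alpha> \<beta> \<zeta> t)) \<in> borel_measurable lborel"
    unfolding jacobi_weight_def by measurable
  ultimately show "set_integrable lborel {-1..1} (\<lambda>t. poly p t * jacobi_weight \<alpha> \<beta> \<zeta> t)"
    by (simp add: set_integrable_def integrable_completion)
next
  fix t :: real
  assume "-1 < t" "t < 1"
  then show "jacobi_weight \<alpha> \<beta> \<zeta> t > 0"
    using \<zeta> by (auto simp: jacobi_weight_def)
qed

section \<open>Connectedness through functions on the vertices\<close>

text \<open>
  A function that agrees at the two ends of every edge is constant along paths. Conversely, the
  indicator function of the set of vertices reachable from a given one is such a function, so if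
  it has to be constant then every vertex is reachable.
\<close>

lemma connected_endpoint_graph_iff:
  assumes "\<And>i. i \<in> {1..N} \<Longrightarrow> l i \<le> N \<and> r i \<le> N"
  shows "Digraph_Component.connected (with_proj (endpoint_graph N l r)) \<longleftrightarrow>
    (\<forall>f :: nat \<Rightarrow> real. (\<forall>i\<in>{1..N}. f (l i) = f (r i)) \<longrightarrow> (\<forall>j\<le>N. f j = f 0))"
    (is "?connected \<longleftrightarrow> ?constant")
proof -
  let ?E = "{(u, v). \<exists>i\<in>{1..N}. {u, v} = {l i, r i}}"
  have verts: "verts (with_proj (mk_symmetric (with_proj (endpoint_graph N l r)))) = {0..N}"
    by (simp add: mk_symmetric_def endpoint_graph_def)
  have arcs: "arcs_ends (with_proj (mk_symmetric (with_proj (endpoint_graph N l r)))) = ?E"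
  proof -
    let ?A = "{(u, v). {u, v} \<in> endpoint_edges N l r}"
    have "arcs_ends (with_proj (mk_symmetric (with_proj (endpoint_graph N l r)))) = ?A \<union> ?A\<inverse>"
      by (auto simp: arcs_ends_def arc_to_ends_def mk_symmetric_def endpoint_graph_def image_iff)
    also have "\<dots> = ?A"
      by (auto simp: insert_commute)
    also have "\<dots> = ?E"
      unfolding endpoint_edges_def by blast
    finally show ?thesis .
  qed
  have connected: "?connected \<longleftrightarrow> (\<forall>u\<in>{0..N}. \<forall>v\<in>{0..N}. (u, v) \<in> rtrancl_on {0..N} ?E)"
    unfolding Digraph_Component.connected_def strongly_connected_def reachable_def verts arcs
    by auto
  show ?thesis
  proof
    assume ?connected
    show ?constant
    proof (intro allI impI)
      fix f :: "nat \<Rightarrow> real" and j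
      assume f: "\<forall>i\<in>{1..N}. f (l i) = f (r i)" and "j \<le> N"
      then have "(0, j) \<in> rtrancl_on {0..N} ?E"
        using \<open>?connected\<close> connected by simp
      then show "f j = f 0"
        by induction (use f in \<open>auto simp: doubleton_eq_iff\<close>)
    qed
  next
    assume const: ?constant
    have reach: "(u, v) \<in> rtrancl_on {0..N} ?E" if "u \<le> N" "v \<le> N" for u v
    proof -
      define f :: "nat \<Rightarrow> real"
        where "f j = of_bool ((u, j) \<in> rtrancl_on {0..N} ?E)" for j
      have "f (l i) = f (r i)" if "i \<in> {1..N}" for i
      proof -
        have "(l i, r i) \<in> ?E" "(r i, l i) \<in> ?E"
          using that by auto
        then have "(u, l i) \<in> rtrancl_on {0..N} ?E \<longleftrightarrow> (u, r i) \<in> rtrancl_on {0..N} ?E"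
          using assms[OF that]
          by (meson atLeastAtMost_iff le0 rtrancl_on_into_rtrancl_on)
        then show ?thesis by (simp add: f_def)
      qed
      then have "f u = f v"
        using const that by metis
      moreover have "f u = 1"
        using that by (simp add: f_def)
      ultimately show ?thesis
        by (simp add: f_def split: if_splits)
    qed
    then show ?connected
      by (simp add: connected)
  qed
qed

section \<open>The bilinear form\<close>

lemma moment_form_diag:
  "moment_form \<alpha> \<beta> \<zeta> N s (mat_diag N d) p q =
    (\<Sum>i<N. d i * vec_index (moment_vec \<alpha> \<beta> \<zeta> N s p) i * vec_index (moment_vec \<alpha> \<beta> \<zeta> N s q) i)"
proof -
  have dim: "moment_vec \<alpha> \<beta> \<zeta> N s u \<in> carrier_vec N" for u
    by (simp add: moment_vec_def)
  have "mat_diag N d *\<^sub>v v = Matrix.vec N (\<lambda>i. d i * vec_index v i)" if "v \<in> carrier_vec N" for v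
    using that
    by (intro eq_vecI)
      (auto simp: mat_diag_def scalar_prod_def if_distrib[where f = "\<lambda>y. y * _"] cong: if_cong)
  then show ?thesis
    unfolding moment_form_def using dim
    by (simp add: scalar_prod_def lessThan_atLeast0 mult_ac)
qed

theorem proposition5:
  fixes N :: nat and x :: "nat \<Rightarrow> real" and l r :: "nat \<Rightarrow> nat"
    and s :: "nat \<Rightarrow> real set" and w :: "nat \<Rightarrow> real" and \<alpha> \<beta> \<zeta> :: real
    and W :: "real mat"
  assumes "N \<ge> 2"
    and "x 0 = -1" and "x N = 1" and "strict_mono_on {0..N} x"
    and "\<And>i. i \<in> {1..N} \<Longrightarrow> l i < r i \<and> r i \<le> N"
    and "\<And>i. i \<in> {1..N} \<Longrightarrow> s i = {x (l i)..x (r i)}"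
    and "\<alpha> > -1" and "\<beta> > -1" and "\<zeta> \<in> {-1, 1}"
    and "\<And>i. i \<in> {1..N} \<Longrightarrow> w i > 0"
    and "W = mat_diag N (\<lambda>i. w (Suc i))"
  shows "Digraph_Component.connected (with_proj (endpoint_graph N l r)) \<longleftrightarrow>
    inner_product_on (poly_space (N - 1)) (moment_form \<alpha> \<beta> \<zeta> N s W)"
proof -
  interpret polynomial_weight "-1" 1 "jacobi_weight \<alpha> \<beta> \<zeta>"
    using assms(7-9) by (rule jacobi_polynomial_weight)
  have "N > 0" using assms(1) by simp
  have x: "strict_mono_on {0..N} x" "-1 \<le> x 0" "x N \<le> 1"
    using assms(2-4) by auto
  let ?B = "moment_form \<alpha> \<beta> \<zeta> N s W"
  let ?F = "\<lambda>p j. moment (x 0) (x j) p"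
  let ?\<mu> = "\<lambda>p i. ?F p (r i) - ?F p (l i)"
  have nodes: "l i \<le> N \<and> r i \<le> N" if "i \<in> {1..N}" for i
    using assms(5)[OF that] by simp
  have connected_iff: "Digraph_Component.connected (with_proj (endpoint_graph N l r)) \<longleftrightarrow>
      (\<forall>f :: nat \<Rightarrow> real. (\<forall>i\<in>{1..N}. f (l i) = f (r i)) \<longrightarrow> (\<forall>j\<le>N. f j = f 0))"
    by (rule connected_endpoint_graph_iff) (rule nodes)
  have lr: "l (Suc i) < r (Suc i)" "r (Suc i) \<le> N" if "i < N" for i
    using assms(5)[of "Suc i"] that by auto
  have moment_vec: "vec_index (moment_vec \<alpha> \<beta> \<zeta> N s p) i = ?\<mu> p (Suc i)" if "i < N" for p i
    using that lr[OF that] assms(6)[of "Suc i"]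
      moment_between_nodes[OF x, of "l (Suc i)" "r (Suc i)" p]
    by (simp add: moment_vec_def moment_def)
  have B: "?B p q = (\<Sum>i<N. w (Suc i) * ?\<mu> p (Suc i) * ?\<mu> q (Suc i))" for p q
    unfolding assms(11) moment_form_diag by (intro sum.cong) (simp_all add: moment_vec)
  have mem: "p \<in> poly_space (N - 1) \<longleftrightarrow> degree p < N" for p
    using \<open>N > 0\<close> by (auto simp: poly_space_def)
  have F_add: "?F (p + q) j = ?F p j + ?F q j" if "j \<le> N" for p q j
    using that strict_mono_on_leD[OF x(1), of j N] x by (intro moment_add) auto
  have B_add: "?B (p + q) u = ?B p u + ?B q u" for p q u
    unfolding B sum.distrib[symmetric]
  proof (rule sum.cong[OF refl])
    fix i assume "i \<in> {..<N}"
    then have "?\<mu> (p + q) (Suc i) = ?\<mu> p (Suc i) + ?\<mu> q (Suc i)"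
      using lr[of i] F_add[of "l (Suc i)" p q] F_add[of "r (Suc i)" p q] by simp
    then show "w (Suc i) * ?\<mu> (p + q) (Suc i) * ?\<mu> u (Suc i) =
        w (Suc i) * ?\<mu> p (Suc i) * ?\<mu> u (Suc i) + w (Suc i) * ?\<mu> q (Suc i) * ?\<mu> u (Suc i)"
      by (simp only: distrib_left distrib_right)
  qed
  have B_smult: "?B (Polynomial.smult c p) q = c * ?B p q" for c p q
    by (simp add: B moment_smult sum_distrib_left algebra_simps)
  have B_sym: "?B p q = ?B q p" for p q
    by (simp add: B mult_ac)
  have B_nonneg: "?B p p \<ge> 0" for p
    unfolding B using assms(10) by (intro sum_nonneg) (simp add: mult.assoc less_imp_le)
  have B_zero: "?B p p = 0 \<longleftrightarrow> (\<forall>i\<in>{1..N}. ?F p (l i) = ?F p (r i))" for p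
  proof -
    have "?B p p = 0 \<longleftrightarrow> (\<forall>i<N. w (Suc i) * ?\<mu> p (Suc i) * ?\<mu> p (Suc i) = 0)"
      unfolding B using assms(10)
      by (subst sum_nonneg_eq_0_iff) (auto simp: mult.assoc less_imp_le)
    also have "\<dots> \<longleftrightarrow> (\<forall>i<N. ?F p (l (Suc i)) = ?F p (r (Suc i)))"
    proof -
      have "w (Suc i) \<noteq> 0" if "i < N" for i
        using assms(10)[of "Suc i"] that by simp
      then show ?thesis by auto
    qed
    also have "\<dots> \<longleftrightarrow> (\<forall>i\<in>{1..N}. ?F p (l i) = ?F p (r i))"
      unfolding image_Suc_lessThan[symmetric] by auto
    finally show ?thesis .
  qed
  have "inner_product_on (poly_space (N - 1)) ?B \<longleftrightarrow> (\<forall>p. degree p < N \<longrightarrow> ?B p p = 0 \<longrightarrow> p = 0)"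
    (is "_ \<longleftrightarrow> ?definite")
  proof -
    have "inner_product_on (poly_space (N - 1)) ?B \<longleftrightarrow>
        (\<forall>p\<in>poly_space (N - 1). p \<noteq> 0 \<longrightarrow> ?B p p > 0)"
      (is "?inner \<longleftrightarrow> ?pos")
    proof
      assume ?inner
      then show ?pos
        unfolding inner_product_on_def by (elim conjE)
    next
      assume pos: ?pos
      show ?inner
        unfolding inner_product_on_def
        by (intro conjI ballI allI B_sym B_add B_smult) (use pos in blast)
    qed
    also have "\<dots> \<longleftrightarrow> ?definite"
    proof -
      have "?B p p > 0 \<longleftrightarrow> ?B p p \<noteq> 0" for p
        using B_nonneg[of p] by linarith
      then show ?thesis
        unfolding Ball_def mem by blast
    qed
    finally show ?thesis .
  qed
  also have "\<dots> \<longleftrightarrow> Digraph_Component.connected (with_proj (endpoint_graph N l r))"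
    (is "_ \<longleftrightarrow> ?connected")
  proof
    assume ?connected
    show ?definite
    proof (intro allI impI)
      fix p assume p: "degree p < N" "?B p p = 0"
      have const: "\<forall>j\<le>N. ?F p j = ?F p 0"
        using spec[OF iffD1[OF connected_iff \<open>?connected\<close>], of "?F p"] p(2)
        unfolding B_zero by (rule mp)
      have "moment (x j) (x (Suc j)) p = 0" if "j < N" for j
      proof -
        have "?F p j = ?F p 0" "?F p (Suc j) = ?F p 0"
          using const that by (meson Suc_leI less_imp_le)+
        then show ?thesis
          using that moment_between_nodes[OF x, of j "Suc j" p] by simp
      qed
      with x p(1) show "p = 0"
        by (intro cell_moments_zero_imp_zero)
    qed
  next
    assume definite: ?definite
    show ?connected
      unfolding connected_iff
    proof (rule allI, rule impI)
      fix f :: "nat \<Rightarrow> real"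
      assume f: "\<forall>i\<in>{1..N}. f (l i) = f (r i)"
      obtain p where p: "degree p < N" "\<And>j. j \<le> N \<Longrightarrow> ?F p j = f j - f 0"
        using polynomial_with_nodal_primitive[OF x \<open>N > 0\<close>] by blast
      have "?B p p = 0"
        unfolding B_zero using f p(2) nodes by simp
      with definite p(1) have "p = 0" by blast
      show "\<forall>j\<le>N. f j = f 0"
      proof (intro allI impI)
        show "f j = f 0" if "j \<le> N" for j
          using p(2)[OF that] \<open>p = 0\<close> by simp
      qed
    qed
  qed
  finally show ?thesis by blast
qed

end
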